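(* If cancellation is not allowed, then no randomized policy achieves a constant robustness ratio for the knapsack problem with an unknown capacity. That is, for every constant $\alpha>0$ there is an instance of the knapsack problem with an unknown capacity for which no randomized policy (without cancellation) is $\alpha$-robust.
   Context: Knapsack problem with an unknown capacity: an instance is a finite set $I$ of items, each item $i$ having a positive integer size $s(i)$ and a nonnegative weight $w(i)$; the objective is $f(X)=\sum_{i\in X}w(i)$. The capacity $C$ is unknown. Items are tried one at a time, each at most once. When item $i$ is tried and the current knapsack content is $X$, we learn whether $s(X)+s(i)\le C$, where $s(X)=\sum_{j\in X}s(j)$. If so, $i$ is irrevocably added to $X$; otherwise (without cancellation) $i$ is discarded, the process stops, and the output is $X$. An adaptive policy is a binary decision tree specifying the next item to try depending on the observations so far (without cancellation this amounts to a sequence of the items); a randomized policy is a probability distribution over such policies. Let $\mathrm{ALG}_C$ be the (random) output when the capacity is $C$ and let $\mathrm{OPT}_C$ maximize $f(X)$ over $X\subseteq I$ with $s(X)\le C$. The policy is $\alpha$-robust if $\mathbb{E}[f(\mathrm{ALG}_C)]\ge\alpha f(\mathrm{OPT}_C)$ for every $C\in\mathbb{R}_+$. *)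

theory Defs
  imports "HOL-Probability.Probability"
begin

record 'i knapsack =
  items :: "'i set"
  item_size :: "'i \<Rightarrow> nat"
  weight :: "'i \<Rightarrow> real"

definition valid_instance :: "'i knapsack \<Rightarrow> bool" where
  "valid_instance K \<longleftrightarrow> finite (items K) \<and>
     (\<forall>i\<in>items K. item_size K i > 0 \<and> weight K i \<ge> 0)"

definition total_size :: "'i knapsack \<Rightarrow> 'i set \<Rightarrow> nat" where
  "total_size K X = (\<Sum>i\<in>X. item_size K i)"

definition objective :: "'i knapsack \<Rightarrow> 'i set \<Rightarrow> real" where
  "objective K X = (\<Sum>i\<in>X. weight K i)"

definition opt_value :: "'i knapsack \<Rightarrow> real \<Rightarrow> real" where
  "opt_value K C = Max (objective K ` {X. X \<subseteq> items K \<and> real (total_size K X) \<le> C})"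

(* The first subtree of a Try node is followed if the item fits, the second one otherwise. *)
datatype 'i policy = Stop | Try 'i "'i policy" "'i policy"

(* A is the set of items not yet tried, so no item is tried twice on any branch. *)
fun policy_on :: "'i set \<Rightarrow> 'i policy \<Rightarrow> bool" where
  "policy_on A Stop \<longleftrightarrow> True"
| "policy_on A (Try i P Q) \<longleftrightarrow> i \<in> A \<and> policy_on (A - {i}) P \<and> policy_on (A - {i}) Q"

(* X is the current content of the knapsack. Without cancellation the first item that does
   not fit ends the process, so the second subtree of a Try node is never entered. *)
fun run_no_cancel :: "'i knapsack \<Rightarrow> real \<Rightarrow> 'i set \<Rightarrow> 'i policy \<Rightarrow> 'i set" where
  "run_no_cancel K C X Stop = X"
| "run_no_cancel K C X (Try i P Q) =
     (if real (total_size K X + item_size K i) \<le> C then run_no_cancel K C (insert i X) P else X)"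

definition alg_output :: "'i knapsack \<Rightarrow> real \<Rightarrow> 'i policy \<Rightarrow> 'i set" where
  "alg_output K C P = run_no_cancel K C {} P"

(* There are only finitely many policies on a finite item set, so probability mass functions
   cover all distributions and the expectation in robust below is a finite sum. *)
definition randomized_policy :: "'i knapsack \<Rightarrow> 'i policy pmf \<Rightarrow> bool" where
  "randomized_policy K p \<longleftrightarrow> (\<forall>P\<in>set_pmf p. policy_on (items K) P)"

definition robust :: "real \<Rightarrow> 'i knapsack \<Rightarrow> 'i policy pmf \<Rightarrow> bool" where
  "robust \<alpha> K p \<longleftrightarrow> (\<forall>C\<ge>0.
     measure_pmf.expectation p (\<lambda>P. objective K (alg_output K C P)) \<ge> \<alpha> * opt_value K C)"

end

theory Submission
  imports Defs
begin

text \<open>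
  Take \<open>n\<close> items of sizes \<open>n, \<dots>, 2n - 1\<close> and weights \<open>1, n, \<dots>, n\<^sup>n\<^sup>-\<^sup>1\<close>. No two of them fit
  together at a capacity below \<open>2n\<close>, so only the first item tried matters. At capacity \<open>n + k\<close>
  the optimum is the weight \<open>n\<^sup>k\<close> of item \<open>k\<close>, and a policy starting with any other item achieves
  at most a fraction \<open>1/n\<close> of it. Hence the competitive ratios of a policy at these \<open>n\<close> capacities
  add up to at most \<open>1 + n \<cdot> 1/n = 2\<close>. By linearity of expectation the same holds for randomized
  policies, so \<open>\<alpha>\<close>-robustness forces \<open>n\<alpha> \<le> 2\<close>.
\<close>

definition hard_instance :: "nat \<Rightarrow> nat knapsack" where
  "hard_instance n = \<lparr>items = {..<n}, item_size = (\<lambda>i. n + i), weight = (\<lambda>i. real n ^ i)\<rparr>"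

lemma valid_hard_instance: "valid_instance (hard_instance n)"
  by (auto simp: valid_instance_def hard_instance_def)

lemma alg_output_hard_instance:
  assumes "k < n"
  shows "alg_output (hard_instance n) (real n + real k) P =
           (case P of Stop \<Rightarrow> {} | Try i _ _ \<Rightarrow> if i \<le> k then {i} else {})"
proof -
  \<comment> \<open>Any two sizes add up to at least \<open>2 * n\<close>, and \<open>k < n\<close>
    keeps the capacity below that.\<close>
  have "run_no_cancel (hard_instance n) (real n + real k) {i} Q = {i}" for i Q
    using assms by (cases Q) (auto simp: hard_instance_def total_size_def)
  then show ?thesis
    by (cases P) (auto simp: alg_output_def hard_instance_def total_size_def)
qed

text \<open>The singleton \<open>{k}\<close> fills the capacity exactly. A lower bound suffices,
  since the ratios below are taken relative to \<open>n ^ k\<close>.\<close>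

lemma opt_value_hard_instance_ge:
  assumes "k < n"
  shows "real n ^ k \<le> opt_value (hard_instance n) (real n + real k)"
proof -
  have "objective (hard_instance n) {k} \<le> opt_value (hard_instance n) (real n + real k)"
    unfolding opt_value_def
  proof (rule Max_ge)
    show "finite (objective (hard_instance n) `
      {X. X \<subseteq> items (hard_instance n) \<and>
          real (total_size (hard_instance n) X) \<le> real n + real k})"
      by (simp add: hard_instance_def)
  qed (use assms in \<open>auto simp: hard_instance_def total_size_def\<close>)
  then show ?thesis
    by (simp add: objective_def hard_instance_def)
qed

lemma competitive_ratio_hard_instance:
  assumes "k < n"
  shows "objective (hard_instance n) (alg_output (hard_instance n) (real n + real k) P) / real n ^ k =
           (case P of Stop \<Rightarrow> 0 | Try i _ _ \<Rightarrow> if i \<le> k then real n ^ i / real n ^ k else 0)"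
  using alg_output_hard_instance[OF assms, of P]
  by (auto simp: objective_def hard_instance_def split: policy.split)

lemma sum_competitive_ratio_le_2:
  assumes "n > 0"
  shows "(\<Sum>k<n. objective (hard_instance n)
           (alg_output (hard_instance n) (real n + real k) P) / real n ^ k) \<le> 2"
proof (cases P)
  case Stop
  then show ?thesis by (simp add: competitive_ratio_hard_instance)
next
  case (Try i Q R)
  \<comment> \<open>Allowing \<open>1 / n\<close> at every \<open>k\<close>, not only at
    \<open>k > i\<close>, makes these terms sum to exactly 1; the indicator of \<open>k = i\<close>
    adds at most 1.\<close>
  have ratio: "(if i \<le> k then real n ^ i / real n ^ k else 0)
                 \<le> (if k = i then 1 else 0) + 1 / real n" for k
  proof (cases "i < k")
    case True
    then have "real n ^ i * real n \<le> real n ^ k"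
      using power_increasing[of "Suc i" k "real n"] assms by (simp add: mult.commute)
    then show ?thesis using True assms by (simp add: field_simps)
  qed (use assms in auto)
  have "(\<Sum>k<n. objective (hard_instance n)
           (alg_output (hard_instance n) (real n + real k) P) / real n ^ k)
        \<le> (\<Sum>k<n. (if k = i then 1 else 0) + 1 / real n)"
    using ratio by (intro sum_mono) (simp add: competitive_ratio_hard_instance Try)
  also have "\<dots> \<le> 2"
    using assms by (simp add: sum.distrib)
  finally show ?thesis .
qed

text \<open>The support of \<open>p\<close> may be infinite here, so integrability comes from
  boundedness: all ratios lie between 0 and 1.\<close>

lemma integrable_competitive_ratio:
  assumes "k < n"
  shows "integrable (measure_pmf p) (\<lambda>P. objective (hard_instance n)
           (alg_output (hard_instance n) (real n + real k) P) / real n ^ k)"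
proof (rule measure_pmf.integrable_const_bound[where B = 1])
  have "real n ^ i / real n ^ k \<le> 1" if "i \<le> k" for i
    using that assms power_increasing[of i k "real n"] by (simp add: divide_le_eq_1)
  then show "AE P in measure_pmf p. norm (objective (hard_instance n)
           (alg_output (hard_instance n) (real n + real k) P) / real n ^ k) \<le> 1"
    using assms
    by (intro AE_I2, subst competitive_ratio_hard_instance) (auto split: policy.split)
qed simp

lemma robust_hard_instance_le_2:
  assumes "robust \<alpha> (hard_instance n) p" "\<alpha> > 0" "n > 0"
  shows "real n * \<alpha> \<le> 2"
proof -
  let ?r = "\<lambda>k P. objective (hard_instance n)
              (alg_output (hard_instance n) (real n + real k) P) / real n ^ k"
  have "\<alpha> \<le> measure_pmf.expectation p (?r k)" if "k < n" for k
  proof -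
    \<comment> \<open>Positivity of \<alpha> preserves the direction when the optimum replaces its
      lower bound.\<close>
    have "\<alpha> * real n ^ k \<le> \<alpha> * opt_value (hard_instance n) (real n + real k)"
      using opt_value_hard_instance_ge[OF that] \<open>\<alpha> > 0\<close> by simp
    also have "\<dots> \<le> measure_pmf.expectation p (\<lambda>P. objective (hard_instance n)
                     (alg_output (hard_instance n) (real n + real k) P))"
      using assms(1) by (simp add: robust_def)
    finally show ?thesis
      using \<open>n > 0\<close> by (simp add: field_simps)
  qed
  then have "(\<Sum>k<n. \<alpha>) \<le> (\<Sum>k<n. measure_pmf.expectation p (?r k))"
    by (intro sum_mono) auto
  also have "\<dots> = measure_pmf.expectation p (\<lambda>P. \<Sum>k<n. ?r k P)"
    by (rule Bochner_Integration.integral_sum[symmetric])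
       (use integrable_competitive_ratio in blast)
  also have "\<dots> \<le> 2"
    by (rule measure_pmf.integral_le_const, rule Bochner_Integration.integrable_sum)
       (use integrable_competitive_ratio sum_competitive_ratio_le_2[OF \<open>n > 0\<close>] in auto)
  finally show ?thesis by simp
qed

theorem theorem6:
  fixes \<alpha> :: real
  assumes "\<alpha> > 0"
  shows "\<exists>K :: nat knapsack. valid_instance K \<and>
           (\<forall>p. randomized_policy K p \<longrightarrow> \<not> robust \<alpha> K p)"
proof -
  \<comment> \<open>By the Archimedean property, \<open>n\<close> can exceed
    \<open>2 / \<alpha>\<close>, which violates the bound forced by robustness.\<close>
  obtain n where n: "2 < real n * \<alpha>"
    using ex_less_of_nat_mult[OF assms] by blast
  then have "n > 0"
    by (cases n) auto
  then have "\<not> robust \<alpha> (hard_instance n) p" for p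
    using robust_hard_instance_le_2[of \<alpha> n p] assms n by linarith
  then show ?thesis
    using valid_hard_instance by blast
qed

end
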